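(* Let $q$ be a positive integer and let $(a_1,\ldots,a_q)$ be a sequence of non-negative real numbers satisfying \[ \frac{a_1}{\binom q1}\le\frac{a_2}{\binom q2}\le\cdots\le\frac{a_q}{\binom qq}. \] Then $a_1x+a_2x^2+\cdots+a_qx^q$ is an approximate well-covered independence polynomial (of degree $q$).
   Context: For a graph $G$, $i_k(G)$ is the number of independent sets of size $k$ in $G$. A graph is well-covered if all its maximal independent sets have the same size; its independence number is the size of a largest independent set. A polynomial $a_qx^q+\cdots+a_1x$ is an approximate well-covered independence polynomial (of degree $q$) if for every real $\epsilon>0$ there exist a well-covered graph $G$ with independence number $q$ and a real number $T$ such that $\left|\frac{i_k(G)}{T}-a_k\right|<\epsilon$ for all $1\le k\le q$. *)

theory Defs
  imports Complex_Main "HOL-Computational_Algebra.Polynomial" "Graph_Theory.Pair_Digraph"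
begin

text \<open>
  A finite simple graph is a \<^locale>\<open>pair_graph\<close>: finite, loop-free, and with a symmetric set of
  arcs, so that an undirected edge between u and v is the pair of arcs (u, v) and (v, u).
\<close>

definition indep_set :: "'a pair_pre_digraph \<Rightarrow> 'a set \<Rightarrow> bool" where
  "indep_set G S \<longleftrightarrow> S \<subseteq> pverts G \<and> (\<forall>u\<in>S. \<forall>v\<in>S. (u, v) \<notin> parcs G)"

definition num_indep_sets :: "'a pair_pre_digraph \<Rightarrow> nat \<Rightarrow> nat" where
  "num_indep_sets G k = card {S. indep_set G S \<and> card S = k}"

definition maximal_indep_set :: "'a pair_pre_digraph \<Rightarrow> 'a set \<Rightarrow> bool" where
  "maximal_indep_set G S \<longleftrightarrow>
     indep_set G S \<and> (\<forall>S'. indep_set G S' \<and> S \<subseteq> S' \<longrightarrow> S' = S)"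

definition well_covered :: "'a pair_pre_digraph \<Rightarrow> bool" where
  "well_covered G \<longleftrightarrow>
     (\<forall>S S'. maximal_indep_set G S \<and> maximal_indep_set G S' \<longrightarrow> card S = card S')"

definition indep_number :: "'a pair_pre_digraph \<Rightarrow> nat" where
  "indep_number G = Max (card ` {S. indep_set G S})"

text \<open>
  The polynomial is a real polynomial of the form \<open>a\<^sub>q x\<^sup>q + \<dots> + a\<^sub>1 x\<close>. The degree \<open>q\<close> is a formal
  parameter: the coefficient \<open>a\<^sub>q\<close> may vanish. Vertices are natural numbers, which is no
  restriction for finite graphs. The condition \<open>T \<noteq> 0\<close> makes explicit that the quotient by \<open>T\<close>
  is meaningful, as division by zero is total in HOL.
\<close>

definition approx_well_covered_indep_poly :: "nat \<Rightarrow> real poly \<Rightarrow> bool" where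
  "approx_well_covered_indep_poly q p \<longleftrightarrow>
     degree p \<le> q \<and> coeff p 0 = 0 \<and>
     (\<forall>\<epsilon>>0. \<exists>(G :: nat pair_pre_digraph) (T :: real).
        pair_graph G \<and> well_covered G \<and> indep_number G = q \<and> T \<noteq> 0 \<and>
        (\<forall>k\<in>{1..q}. \<bar>real (num_indep_sets G k) / T - coeff p k\<bar> < \<epsilon>))"

end

(*
  A non-decreasing sequence a_k / (q choose k) is a non-negative combination of step sequences, so it
  suffices to approximate, for each j < q, the polynomial whose coefficients are (q choose k) for
  k > j and 0 for k <= j; joins then realise the combination.

  Take a secret word w over an alphabet of size n with one letter w_B for every j-subset B of the q
  positions, and let position i know exactly the letters w_B with i not in B. The vertices are the
  possible views of single positions, and two views are non-adjacent when they are consistent.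
  Pairwise consistent views always come from a common word, so every independent set extends to one
  with all q positions. More than j positions together know the whole word, which gives
  (q choose k) * n^(q choose j) independent k-sets for k > j. At most j positions miss some letter,
  which costs a factor of at least n for k <= j.
*)

theory Submission
  imports Defs "HOL-Library.FuncSet"
begin

section \<open>Certifying well-coveredness by extension to size \<open>q\<close>\<close>

lemma finite_indep_sets:
  assumes "pair_graph G"
  shows "finite {X. indep_set G X}"
proof -
  interpret pair_graph G by fact
  show ?thesis
    using pair_finite_verts by (auto simp: indep_set_def intro: finite_subset[of _ "Pow (pverts G)"])
qed

text \<open>A maximal independent set equals each of its independent supersets, in particular one of
  size \<open>q\<close>. Extending the empty set shows that the size \<open>q\<close> is
  attained.\<close>

lemma well_covered_indep_numberI:
  assumes G: "pair_graph G"
    and ext: "\<And>X. indep_set G X \<Longrightarrow> \<exists>Y. indep_set G Y \<and> X \<subseteq> Y \<and> card Y = q"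
    and le: "\<And>X. indep_set G X \<Longrightarrow> card X \<le> q"
  shows "well_covered G" "indep_number G = q"
proof -
  have "card X = q" if "maximal_indep_set G X" for X
    using that ext[of X] unfolding maximal_indep_set_def by auto
  then show "well_covered G" by (simp add: well_covered_def)
  have "indep_set G {}" by (simp add: indep_set_def)
  then obtain Y where "indep_set G Y" "card Y = q" using ext by blast
  then show "indep_number G = q"
    unfolding indep_number_def using finite_indep_sets[OF G] le by (intro Max_eqI) auto
qed

section \<open>Relabelling vertices along an injection\<close>

definition map_graph :: "('a \<Rightarrow> 'b) \<Rightarrow> 'a pair_pre_digraph \<Rightarrow> 'b pair_pre_digraph" where
  "map_graph f G = \<lparr>pverts = f ` pverts G, parcs = map_prod f f ` parcs G\<rparr>"

context
  fixes f :: "'a \<Rightarrow> 'b" and G :: "'a pair_pre_digraph"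
  assumes G: "pair_graph G" and f: "inj_on f (pverts G)"
begin

interpretation pair_graph G by (rule G)

lemma pair_graph_map_graph: "pair_graph (map_graph f G)"
proof -
  have sym: "(v, u) \<in> parcs G" if "(u, v) \<in> parcs G" for u v
    using pair_sym_arcs that by (auto simp: symmetric_def sym_def)
  show ?thesis
  proof
    show "Digraph.symmetric (with_proj (map_graph f G))"
      using sym by (force simp: symmetric_def sym_def map_graph_def)
    show "fst e \<noteq> snd e" if e: "e \<in> parcs (map_graph f G)" for e
    proof -
      obtain u v where uv: "(u, v) \<in> parcs G" "e = (f u, f v)"
        using e by (auto simp: map_graph_def)
      then have "u \<noteq> v" using pair_no_loops[of "(u, v)"] by simp
      then show ?thesis using uv in_arcsD1 in_arcsD2 inj_onD[OF f] by auto
    qed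
  qed (use wellformed' pair_finite_verts pair_finite_arcs in \<open>auto simp: map_graph_def\<close>)
qed

lemma indep_set_map_graph_image:
  assumes "X \<subseteq> pverts G"
  shows "indep_set (map_graph f G) (f ` X) \<longleftrightarrow> indep_set G X"
proof -
  have "(f u, f v) \<in> parcs (map_graph f G) \<longleftrightarrow> (u, v) \<in> parcs G" if "u \<in> X" "v \<in> X" for u v
  proof
    assume "(f u, f v) \<in> parcs (map_graph f G)"
    then obtain u' v' where uv: "(u', v') \<in> parcs G" "f u = f u'" "f v = f v'"
      by (auto simp: map_graph_def)
    then have "u = u'" "v = v'"
      using that assms in_arcsD1[OF uv(1)] in_arcsD2[OF uv(1)] by (auto intro: inj_onD[OF f])
    then show "(u, v) \<in> parcs G" using uv by simp
  qed (force simp: map_graph_def)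
  then show ?thesis using assms by (auto simp: indep_set_def map_graph_def)
qed

lemma indep_set_map_graph:
  "indep_set (map_graph f G) Y \<longleftrightarrow> (\<exists>X. indep_set G X \<and> Y = f ` X)"
proof
  assume Y: "indep_set (map_graph f G) Y"
  then have "Y \<subseteq> f ` pverts G" by (simp add: indep_set_def map_graph_def)
  then obtain X where "X \<subseteq> pverts G" "Y = f ` X" by (auto simp: subset_image_iff)
  then show "\<exists>X. indep_set G X \<and> Y = f ` X" using Y indep_set_map_graph_image by blast
next
  assume "\<exists>X. indep_set G X \<and> Y = f ` X"
  then show "indep_set (map_graph f G) Y"
    using indep_set_map_graph_image by (auto simp: indep_set_def)
qed

lemma card_image_indep_set: "indep_set G X \<Longrightarrow> card (f ` X) = card X"
  using f by (auto simp: indep_set_def intro: card_image inj_on_subset)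

lemma num_indep_sets_map_graph: "num_indep_sets (map_graph f G) k = num_indep_sets G k"
proof -
  have "{Y. indep_set (map_graph f G) Y \<and> card Y = k} = (`) f ` {X. indep_set G X \<and> card X = k}"
    using card_image_indep_set by (auto simp: indep_set_map_graph)
  moreover have "inj_on ((`) f) {X. indep_set G X \<and> card X = k}"
    using f by (auto simp: indep_set_def inj_on_def dest: inj_on_image_eq_iff[THEN iffD1, rotated 3])
  ultimately show ?thesis by (simp add: num_indep_sets_def card_image)
qed

end

section \<open>The graph of views of a hidden word\<close>

text \<open>
  Here \<open>c\<close> selects a component of a join; within it, position \<open>i\<close> sees the coordinates \<open>D c i\<close> of a
  hidden word over \<open>{..<n}\<close>. A vertex records a position together with what is seen there, and two
  vertices are adjacent when they cannot come from the same word.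
\<close>

locale view_graph =
  fixes C :: "'c set" and D :: "'c \<Rightarrow> nat \<Rightarrow> 'd set" and n q :: nat
  assumes finite_C: "finite C" and C_nonempty: "C \<noteq> {}"
    and finite_D: "\<And>c i. c \<in> C \<Longrightarrow> i < q \<Longrightarrow> finite (D c i)"
    and n_pos: "n > 0"
begin

definition views :: "('c \<times> nat \<times> ('d \<Rightarrow> nat)) set" where
  "views = (SIGMA c:C. SIGMA i:{..<q}. D c i \<rightarrow>\<^sub>E {..<n})"

text \<open>The condition \<open>c = c'\<close> makes vertices of different components adjacent, as
  in a join. Distinct views of one position differ on some coordinate of \<open>D c i\<close>, so an
  independent set uses each position at most once.\<close>

fun agree :: "'c \<times> nat \<times> ('d \<Rightarrow> nat) \<Rightarrow> 'c \<times> nat \<times> ('d \<Rightarrow> nat) \<Rightarrow> bool" where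
  "agree (c, i, v) (c', i', v') \<longleftrightarrow> c = c' \<and> (\<forall>x\<in>D c i \<inter> D c i'. v x = v' x)"

definition graph :: "('c \<times> nat \<times> ('d \<Rightarrow> nat)) pair_pre_digraph" where
  "graph = \<lparr>pverts = views, parcs = {(u, w). u \<in> views \<and> w \<in> views \<and> \<not> agree u w}\<rparr>"

text \<open>Partial words, recorded only on the coordinates that \<open>S\<close> sees, so that the
  views from \<open>S\<close> determine the word.\<close>

definition words :: "'c \<Rightarrow> nat set \<Rightarrow> ('d \<Rightarrow> nat) set" where
  "words c S = (\<Union>i\<in>S. D c i) \<rightarrow>\<^sub>E {..<n}"

definition face :: "'c \<Rightarrow> nat set \<Rightarrow> ('d \<Rightarrow> nat) \<Rightarrow> ('c \<times> nat \<times> ('d \<Rightarrow> nat)) set" where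
  "face c S g = (\<lambda>i. (c, i, restrict g (D c i))) ` S"

lemma finite_views: "finite views"
  unfolding views_def using finite_C finite_D by (intro finite_SigmaI finite_PiE) auto

lemma pair_graph_graph: "pair_graph graph"
proof
  have *: "agree u w \<Longrightarrow> agree w u" for u w
    by (induction u w rule: agree.induct) auto
  have "agree u u" for u by (cases u) auto
  then show "fst e \<noteq> snd e" if "e \<in> parcs graph" for e
    using that by (auto simp: graph_def)
  show "Digraph.symmetric (with_proj graph)"
    using * by (simp add: symmetric_def sym_def graph_def del: split_paired_All) blast
  show "finite (parcs graph)"
    by (rule finite_subset[of _ "views \<times> views"]) (use finite_views in \<open>auto simp: graph_def\<close>)
qed (use finite_views in \<open>auto simp: graph_def\<close>)

lemma indep_set_graph:
  "indep_set graph X \<longleftrightarrow> X \<subseteq> views \<and> (\<forall>u\<in>X. \<forall>w\<in>X. agree u w)"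
  unfolding indep_set_def graph_def by simp blast

lemma card_face: "card (face c S g) = card S"
  unfolding face_def by (rule card_image) (auto simp: inj_on_def)

lemma indep_set_face:
  assumes "c \<in> C" "S \<subseteq> {..<q}" "g \<in> words c S"
  shows "indep_set graph (face c S g)"
  using assms by (auto simp: indep_set_graph face_def views_def words_def)

text \<open>Pairwise agreement means that all views in \<open>X\<close> seeing a coordinate give it
  the same letter, so they glue to one partial word.\<close>

lemma indep_set_eq_face:
  assumes X: "indep_set graph X"
  obtains c S g where "c \<in> C" "S \<subseteq> {..<q}" "g \<in> words c S" "X = face c S g"
proof (cases "X = {}")
  case True
  \<comment> \<open>The empty set is the face with \<open>S = {}\<close> in any component; its only
    word is undefined everywhere.\<close>
  then show ?thesis
    using C_nonempty that[of _ "{}" "\<lambda>_. undefined"] by (auto simp: words_def face_def)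
next
  case False
  then obtain u\<^sub>0 c where u\<^sub>0: "u\<^sub>0 \<in> X" "fst u\<^sub>0 = c" by blast
  have fst_eq: "fst u = c" if "u \<in> X" for u
  proof -
    have "agree u u\<^sub>0" using u\<^sub>0 that X by (simp add: indep_set_graph)
    then show ?thesis using u\<^sub>0 by (cases u; cases u\<^sub>0) simp
  qed
  have views: "i < q" "v \<in> D c i \<rightarrow>\<^sub>E {..<n}" if "(c, i, v) \<in> X" for i v
    using that X by (auto simp: indep_set_graph views_def)
  have cC: "c \<in> C" using u\<^sub>0 X by (auto simp: indep_set_graph views_def)
  define S where "S = (\<lambda>u. fst (snd u)) ` X"
  have S: "i \<in> S \<longleftrightarrow> (\<exists>v. (c, i, v) \<in> X)" for i
    using fst_eq by (force simp: S_def image_iff)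
  \<comment> \<open>The letter at \<open>x\<close> is taken from an arbitrary view in
    \<open>X\<close> that sees \<open>x\<close>; agreement makes the choice irrelevant.\<close>
  define y where "y x = (SOME y. \<exists>i v. (c, i, v) \<in> X \<and> x \<in> D c i \<and> y = v x)" for x
  have y: "y x = v x" if "(c, i, v) \<in> X" "x \<in> D c i" for i v x
  proof -
    have "\<exists>i v. (c, i, v) \<in> X \<and> x \<in> D c i \<and> y x = v x"
      unfolding y_def by (rule someI_ex) (use that in blast)
    then show ?thesis using that X by (fastforce simp: indep_set_graph)
  qed
  define g where "g = restrict y (\<Union>i\<in>S. D c i)"
  have v: "v = restrict g (D c i)" if "(c, i, v) \<in> X" for i v
  proof
    fix x
    show "v x = restrict g (D c i) x"
      using that y[OF that] views(2)[OF that] S by (auto simp: g_def PiE_def extensional_def)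
  qed
  show ?thesis
  proof
    show "c \<in> C" by (rule cC)
    show "S \<subseteq> {..<q}" using S views by auto
    show "g \<in> words c S"
      using S y views(2) by (fastforce simp: words_def g_def PiE_def Pi_def)
    show "X = face c S g"
    proof
      show "X \<subseteq> face c S g"
      proof
        fix u assume u: "u \<in> X"
        obtain i w where "u = (c, i, w)" using fst_eq[OF u] by (cases u) auto
        then show "u \<in> face c S g" using u v[of i w] S[of i] by (auto simp: face_def)
      qed
      show "face c S g \<subseteq> X" using v S by (auto simp: face_def)
    qed
  qed
qed

lemma indep_set_extend:
  assumes "indep_set graph X"
  shows "\<exists>Y. indep_set graph Y \<and> X \<subseteq> Y \<and> card Y = q"
proof -
  obtain c S g where X: "c \<in> C" "S \<subseteq> {..<q}" "g \<in> words c S" "X = face c S g"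
    using indep_set_eq_face[OF assms] by blast
  \<comment> \<open>The word is completed to all coordinates of the component. Those unseen by
    \<open>S\<close> get the letter 0, which lies in the alphabet since
    \<open>n > 0\<close>.\<close>
  define h where "h = (\<lambda>x\<in>\<Union>i\<in>{..<q}. D c i. if x \<in> (\<Union>i\<in>S. D c i) then g x else 0)"
  have "h \<in> words c {..<q}"
    using X n_pos by (auto simp: words_def h_def)
  moreover have "restrict g (D c i) = restrict h (D c i)" if "i \<in> S" for i
    using that X(2) by (auto simp: h_def restrict_def fun_eq_iff)
  then have "X \<subseteq> face c {..<q} h"
    using X by (auto simp: face_def)
  ultimately show ?thesis
    using X(1) indep_set_face[of c "{..<q}" h] card_face[of c "{..<q}" h] by auto
qed

lemma card_indep_set_le:
  assumes "indep_set graph X"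
  shows "card X \<le> q"
proof -
  obtain c S g where "S \<subseteq> {..<q}" "X = face c S g"
    using indep_set_eq_face[OF assms] by blast
  then show ?thesis using card_mono[of "{..<q}" S] by (simp add: card_face)
qed

text \<open>Component and positions are read off the vertices, and each coordinate of the word is
  seen from some position of \<open>S\<close>. With \<open>S\<close> empty the component would be
  lost.\<close>

lemma face_inject:
  assumes "face c S g = face c' S' g'" "S \<noteq> {}" "g \<in> words c S" "g' \<in> words c' S'"
  shows "c = c' \<and> S = S' \<and> g = g'"
proof -
  have "fst ` face c S g = {c}" "(\<lambda>u. fst (snd u)) ` face c S g = S"
    using assms(2) by (auto simp: face_def image_image)
  moreover have S': "(\<lambda>u. fst (snd u)) ` face c' S' g' = S'"
    by (auto simp: face_def image_image)
  ultimately have S: "S = S'" using assms(1) by simp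
  then have "fst ` face c' S' g' = {c'}" using assms(2) by (auto simp: face_def image_image)
  with \<open>fst ` face c S g = {c}\<close> assms(1) have c: "c = c'" by simp
  have "restrict g (D c i) = restrict g' (D c i)" if "i \<in> S" for i
  proof -
    have "(c, i, restrict g (D c i)) \<in> face c S g'"
      using assms(1) that S c by (force simp: face_def)
    then show ?thesis by (auto simp: face_def)
  qed
  then have "g x = g' x" if "i \<in> S" "x \<in> D c i" for i x
    using that by (metis restrict_apply')
  then have "g = g'"
    using assms(3,4) S c unfolding words_def by (intro PiE_ext) auto
  with S c show ?thesis by simp
qed

text \<open>Independent \<open>k\<close>-sets correspond to triples of a component, a
  \<open>k\<close>-set of positions and a partial word. The case \<open>k = 0\<close> differs
  because the empty set is a face of every component.\<close>

lemma num_indep_sets_graph: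
  assumes "k > 0"
  shows "num_indep_sets graph k =
    (\<Sum>c\<in>C. \<Sum>S | S \<subseteq> {..<q} \<and> card S = k. n ^ card (\<Union>i\<in>S. D c i))"
proof -
  let ?I = "SIGMA c:C. SIGMA S:{S. S \<subseteq> {..<q} \<and> card S = k}. words c S"
  have "{X. indep_set graph X \<and> card X = k} = (\<lambda>(c, S, g). face c S g) ` ?I"
  proof
    show "{X. indep_set graph X \<and> card X = k} \<subseteq> (\<lambda>(c, S, g). face c S g) ` ?I"
    proof
      fix X assume X: "X \<in> {X. indep_set graph X \<and> card X = k}"
      then obtain c S g where "c \<in> C" "S \<subseteq> {..<q}" "g \<in> words c S" "X = face c S g"
        using indep_set_eq_face by blast
      with X show "X \<in> (\<lambda>(c, S, g). face c S g) ` ?I"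
        by (auto simp: card_face intro!: image_eqI[of _ _ "(c, S, g)"])
    qed
  qed (auto simp: card_face intro: indep_set_face)
  moreover have "inj_on (\<lambda>(c, S, g). face c S g) ?I"
    using assms by (auto simp: inj_on_def dest!: face_inject)
  ultimately have "num_indep_sets graph k = card ?I"
    by (simp add: num_indep_sets_def card_image)
  also have fin_union: "finite (\<Union>i\<in>S. D c i)" if "c \<in> C" "S \<subseteq> {..<q}" for c S
    using that finite_D finite_subset[of S "{..<q}"] by (intro finite_UN_I) auto
  then have fin_words: "finite (words c S)" if "c \<in> C" "S \<subseteq> {..<q}" for c S
    using that unfolding words_def by (intro finite_PiE) auto
  then have "card ?I = (\<Sum>c\<in>C. card (SIGMA S:{S. S \<subseteq> {..<q} \<and> card S = k}. words c S))"
    using finite_C by (intro card_SigmaI ballI finite_SigmaI) auto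
  also have "\<dots> = (\<Sum>c\<in>C. \<Sum>S | S \<subseteq> {..<q} \<and> card S = k. card (words c S))"
    using fin_words by (intro sum.cong refl card_SigmaI) auto
  also have "\<dots> = (\<Sum>c\<in>C. \<Sum>S | S \<subseteq> {..<q} \<and> card S = k. n ^ card (\<Union>i\<in>S. D c i))"
    using fin_union by (intro sum.cong) (auto simp: words_def card_PiE)
  finally show ?thesis .
qed

end

text \<open>Transfers the construction from triples to natural-number vertices, as the definition of
  approximability demands.\<close>

lemma view_graph_on_nat:
  assumes "view_graph C D n q"
  obtains G :: "nat pair_pre_digraph" where "pair_graph G" "well_covered G" "indep_number G = q"
    "\<And>k. k > 0 \<Longrightarrow> num_indep_sets G k =
      (\<Sum>c\<in>C. \<Sum>S | S \<subseteq> {..<q} \<and> card S = k. n ^ card (\<Union>i\<in>S. D c i))"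
proof -
  interpret view_graph C D n q by fact
  have fin: "finite (pverts graph)" using finite_views by (simp add: graph_def)
  obtain f :: "_ \<Rightarrow> nat" where f: "inj_on f (pverts graph)"
    using finite_imp_inj_to_nat_seg[OF fin] by auto
  note map = pair_graph_graph f
  let ?G = "map_graph f graph"
  have ext: "\<exists>Z. indep_set ?G Z \<and> Y \<subseteq> Z \<and> card Z = q" if Y: "indep_set ?G Y" for Y
  proof -
    obtain X where X: "indep_set graph X" "Y = f ` X"
      using Y unfolding indep_set_map_graph[OF map] by blast
    obtain Z where Z: "indep_set graph Z" "X \<subseteq> Z" "card Z = q"
      using indep_set_extend[OF X(1)] by blast
    show ?thesis
    proof (intro exI conjI)
      show "indep_set ?G (f ` Z)" unfolding indep_set_map_graph[OF map] using Z(1) by blast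
      show "Y \<subseteq> f ` Z" using X(2) Z(2) by blast
      show "card (f ` Z) = q" using card_image_indep_set[OF map Z(1)] Z(3) by simp
    qed
  qed
  have le: "card Y \<le> q" if Y: "indep_set ?G Y" for Y
  proof -
    obtain X where X: "indep_set graph X" "Y = f ` X"
      using Y unfolding indep_set_map_graph[OF map] by blast
    then show ?thesis
      using card_image_indep_set[OF map X(1)] card_indep_set_le[OF X(1)] by simp
  qed
  have G: "pair_graph ?G" by (rule pair_graph_map_graph[OF map])
  show ?thesis
    by (rule that[OF G well_covered_indep_numberI[OF G ext le]])
      (simp_all only: num_indep_sets_map_graph[OF map] num_indep_sets_graph)
qed

section \<open>Step sequences from coordinates indexed by \<open>j\<close>-subsets\<close>

definition missing_coords :: "nat \<Rightarrow> nat \<Rightarrow> nat \<Rightarrow> nat set set" where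
  "missing_coords q j i = {B. B \<subseteq> {..<q} \<and> card B = j \<and> i \<notin> B}"

lemma finite_missing_coords: "finite (missing_coords q j i)"
  by (rule finite_subset[of _ "Pow {..<q}"]) (auto simp: missing_coords_def)

text \<open>A coordinate \<open>B\<close> is hidden from all of \<open>S\<close> exactly when
  \<open>S \<subseteq> B\<close>, which is impossible for \<open>card S > j\<close>.\<close>

lemma card_UN_missing_coords:
  assumes "S \<subseteq> {..<q}" "card S > j"
  shows "card (\<Union>i\<in>S. missing_coords q j i) = q choose j"
proof -
  have "\<not> S \<subseteq> B" if "B \<subseteq> {..<q}" "card B = j" for B
    using that assms card_mono[of B S] finite_subset[of B "{..<q}"] by auto
  then have "(\<Union>i\<in>S. missing_coords q j i) = {B. B \<subseteq> {..<q} \<and> card B = j}"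
    by (auto simp: missing_coords_def)
  then show ?thesis by (simp add: n_subsets)
qed

text \<open>Some \<open>j\<close>-set \<open>B\<close> contains \<open>S\<close>, and that
  coordinate is hidden from all of \<open>S\<close>.\<close>

lemma card_UN_missing_coords_less:
  assumes "S \<subseteq> {..<q}" "card S \<le> j" "j \<le> q"
  shows "card (\<Union>i\<in>S. missing_coords q j i) < q choose j"
proof -
  obtain B where "S \<subseteq> B" "B \<subseteq> {..<q}" "card B = j"
    using exists_subset_between[of S j "{..<q}"] assms by auto
  then have "B \<in> {B. B \<subseteq> {..<q} \<and> card B = j} - (\<Union>i\<in>S. missing_coords q j i)"
    by (auto simp: missing_coords_def)
  moreover have "(\<Union>i\<in>S. missing_coords q j i) \<subseteq> {B. B \<subseteq> {..<q} \<and> card B = j}"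
    by (auto simp: missing_coords_def)
  ultimately have "(\<Union>i\<in>S. missing_coords q j i) \<subset> {B. B \<subseteq> {..<q} \<and> card B = j}"
    by blast
  then have "card (\<Union>i\<in>S. missing_coords q j i) < card {B. B \<subseteq> {..<q} \<and> card B = j}"
    by (intro psubset_card_mono) auto
  then show ?thesis by (simp add: n_subsets)
qed

text \<open>Here \<open>b\<close> is the height of the step and \<open>t\<close> the weight given to
  the graph. Each \<open>S\<close> errs by at most \<open>(b + 1) / n\<close>: for
  \<open>j < k\<close> only the rounding of \<open>b\<close> matters, otherwise at least one factor
  \<open>n\<close> is lost. There are \<open>q choose k\<close> sets \<open>S\<close>.\<close>

lemma step_graph_sum:
  fixes q n j k :: nat and t b :: real
  assumes n: "n > 0" and j: "j < q" and b: "b \<ge> 0"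
    and t: "b \<le> t * real n ^ (q choose j)" "t * real n ^ (q choose j) \<le> b + 1 / n"
  shows "\<bar>t * (\<Sum>S | S \<subseteq> {..<q} \<and> card S = k. real n ^ card (\<Union>i\<in>S. missing_coords q j i))
      - real (q choose k) * (if j < k then b else 0)\<bar> \<le> real (q choose k) * (b + 1) / n"
proof -
  let ?S = "{S. S \<subseteq> {..<q} \<and> card S = k}"
  let ?e = "\<lambda>S. card (\<Union>i\<in>S. missing_coords q j i)"
  have card: "card ?S = q choose k" using n_subsets[of "{..<q}" k] by simp
  have "0 \<le> t * real n ^ (q choose j)" using t b by linarith
  moreover have "real n ^ (q choose j) > 0" using n by simp
  ultimately have t0: "t \<ge> 0" by (meson mult_neg_pos not_le)
  have "\<bar>t * real n ^ ?e S - (if j < k then b else 0)\<bar> \<le> (b + 1) / n" if "S \<in> ?S" for S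
  proof (cases "j < k")
    case True
    then have eq: "t * real n ^ ?e S = t * real n ^ (q choose j)"
      using card_UN_missing_coords[of S q j] that by simp
    have "1 / n \<le> (b + 1) / n" using b n by (simp add: divide_right_mono)
    then have "\<bar>t * real n ^ (q choose j) - b\<bar> \<le> (b + 1) / n" using t by linarith
    then show ?thesis unfolding eq using True by simp
  next
    case False
    then have "Suc (?e S) \<le> q choose j"
      using card_UN_missing_coords_less[of S q j] that j by simp
    then have "real n ^ Suc (?e S) \<le> real n ^ (q choose j)"
      using n by (intro power_increasing) auto
    then have "t * real n ^ Suc (?e S) \<le> b + 1 / n"
      using t0 t by (meson mult_left_mono order_trans)
    also have "1 / n \<le> 1" using n by simp
    finally have "t * real n ^ ?e S \<le> (b + 1) / n" using n by (simp add: field_simps)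
    then show ?thesis using False t0 by simp
  qed
  then have "\<bar>\<Sum>S\<in>?S. t * real n ^ ?e S - (if j < k then b else 0)\<bar>
      \<le> (\<Sum>S\<in>?S. (b + 1) / n)"
    by (intro order_trans[OF sum_abs] sum_mono)
  then show ?thesis by (simp add: sum_subtractf sum_distrib_left card)
qed

section \<open>Non-negative combinations of step sequences\<close>

lemma step_combination_approx:
  fixes q :: nat and b :: "nat \<Rightarrow> real"
  assumes q: "q > 0" and b: "\<And>j. j < q \<Longrightarrow> b j \<ge> 0" and \<epsilon>: "\<epsilon> > 0"
  shows "\<exists>(G :: nat pair_pre_digraph) (T :: real).
    pair_graph G \<and> well_covered G \<and> indep_number G = q \<and> T \<noteq> 0 \<and>
    (\<forall>k\<in>{1..q}. \<bar>real (num_indep_sets G k) / T - real (q choose k) * (\<Sum>j<k. b j)\<bar> < \<epsilon>)"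
proof -
  \<comment> \<open>\<open>K / n\<close> bounds the total error for every \<open>k\<close> in
    \<open>{1..q}\<close> at once.\<close>
  define K where "K = (\<Sum>k\<le>q. real (q choose k)) * (\<Sum>j<q. b j + 1)"
  obtain n :: nat where n: "real n > max 1 (K / \<epsilon>)" using reals_Archimedean2 by blast
  then have n0: "n > 0" by simp
  \<comment> \<open>\<open>M\<close> exceeds every \<open>q choose j\<close>, so
    \<open>n ^ (M - (q choose j))\<close> is at least \<open>n\<close> and rounding to an integer
    number of copies costs at most \<open>1 / n\<close>.\<close>
  define M where "M = Suc (\<Sum>j<q. q choose j)"
  have M: "(q choose j) < M" if "j < q" for j
    using that member_le_sum[of j "{..<q}" "\<lambda>j. q choose j"] by (simp add: M_def)
  \<comment> \<open>The number of copies of the \<open>j\<close>-th step graph. \<open>Suc\<close>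
    makes it an upper approximation and keeps it positive even if \<open>b j = 0\<close>, so the
    join is nonempty.\<close>
  define m where "m j = Suc (nat \<lfloor>b j * real n ^ (M - (q choose j))\<rfloor>)" for j
  define t where "t j = real (m j) / real n ^ M" for j
  have t: "b j \<le> t j * real n ^ (q choose j)" "t j * real n ^ (q choose j) \<le> b j + 1 / n"
    if j: "j < q" for j
  proof -
    let ?p = "real n ^ (M - (q choose j))"
    have "real n ^ M = ?p * real n ^ (q choose j)"
      using M[OF j] by (simp flip: power_add)
    then have tp: "t j * real n ^ (q choose j) = m j / ?p"
      using n0 by (simp add: t_def)
    have "0 \<le> b j * ?p" using b[OF j] by simp
    then have m: "b j * ?p \<le> m j" "m j \<le> b j * ?p + 1"
      unfolding m_def by linarith+
    have p: "?p > 0" "?p \<ge> n"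
      using n0 M[OF j] self_le_power[of "real n" "M - (q choose j)"] by auto
    show "b j \<le> t j * real n ^ (q choose j)"
      unfolding tp using m p by (simp add: pos_le_divide_eq)
    have "m j / ?p \<le> (b j * ?p + 1) / ?p" using m p by (intro divide_right_mono) auto
    also have "\<dots> = b j + 1 / ?p" using n0 by (simp add: add_divide_distrib)
    also have "1 / ?p \<le> 1 / n" using p n0 by (intro divide_left_mono) auto
    finally show "t j * real n ^ (q choose j) \<le> b j + 1 / n" unfolding tp by simp
  qed
  \<comment> \<open>A component \<open>(j, l)\<close> is the \<open>l\<close>-th copy of the
    \<open>j\<close>-th step graph. The join adds the counts, and dividing by
    \<open>T = n ^ M\<close> gives this graph the total weight \<open>t j\<close>.\<close>
  let ?C = "SIGMA j:{..<q}. {..<m j}"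
  have "(0, 0) \<in> ?C" using q by (simp add: m_def)
  then have "view_graph ?C (\<lambda>c. missing_coords q (fst c)) n q"
    using n0 by unfold_locales (auto simp: finite_missing_coords)
  then obtain G :: "nat pair_pre_digraph" where
    G: "pair_graph G" "well_covered G" "indep_number G = q" and
    num: "\<And>k. k > 0 \<Longrightarrow> num_indep_sets G k = (\<Sum>c\<in>?C. \<Sum>S | S \<subseteq> {..<q} \<and> card S = k.
      n ^ card (\<Union>i\<in>S. missing_coords q (fst c) i))"
    by (rule view_graph_on_nat) blast
  have "\<bar>real (num_indep_sets G k) / real n ^ M - real (q choose k) * (\<Sum>j<k. b j)\<bar> < \<epsilon>"
    if k: "k \<in> {1..q}" for k
  proof -
    let ?s = "\<lambda>j. \<Sum>S | S \<subseteq> {..<q} \<and> card S = k. real n ^ card (\<Union>i\<in>S. missing_coords q j i)"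
    have "(\<Sum>c\<in>?C. ?s (fst c)) = (\<Sum>j<q. m j * ?s j)"
      using sum.Sigma[of "{..<q}" "\<lambda>j. {..<m j}" "\<lambda>j _. ?s j"] by (simp add: split_def)
    then have "real (num_indep_sets G k) = (\<Sum>j<q. m j * ?s j)"
      using k by (simp add: num)
    then have "real (num_indep_sets G k) / real n ^ M = (\<Sum>j<q. t j * ?s j)"
      by (simp add: t_def sum_divide_distrib)
    moreover have "(\<Sum>j<k. b j) = (\<Sum>j<q. if j < k then b j else 0)"
      using k by (intro sum.mono_neutral_cong_left) auto
    ultimately have "\<bar>real (num_indep_sets G k) / real n ^ M - real (q choose k) * (\<Sum>j<k. b j)\<bar>
        = \<bar>\<Sum>j<q. t j * ?s j - real (q choose k) * (if j < k then b j else 0)\<bar>"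
      by (simp add: sum_distrib_left sum_subtractf)
    also have "\<dots> \<le> (\<Sum>j<q. real (q choose k) * (b j + 1) / n)"
      by (rule order_trans[OF sum_abs], rule sum_mono) (use step_graph_sum n0 b t in auto)
    also have "\<dots> = real (q choose k) * (\<Sum>j<q. b j + 1) / n"
      by (simp add: sum_distrib_left sum_divide_distrib)
    also have "\<dots> \<le> K / n"
      unfolding K_def using k b
      by (intro divide_right_mono mult_right_mono sum_nonneg member_le_sum)
        (auto intro: add_nonneg_nonneg)
    also have "\<dots> < \<epsilon>" using n n0 \<epsilon> by (simp add: field_simps)
    finally show ?thesis .
  qed
  then show ?thesis using G n0 by (intro exI[of _ G] exI[of _ "real n ^ M"]) auto
qed

theorem theorem3p1:
  fixes q :: nat and a :: "nat \<Rightarrow> real"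
  assumes "q > 0"
    and "\<And>k. k \<in> {1..q} \<Longrightarrow> a k \<ge> 0"
    and "\<And>k. k \<in> {1..<q} \<Longrightarrow>
           a k / real (q choose k) \<le> a (k + 1) / real (q choose (k + 1))"
  shows "approx_well_covered_indep_poly q (\<Sum>k=1..q. monom (a k) k)"
proof -
  define p where "p = (\<Sum>k=1..q. monom (a k) k)"
  \<comment> \<open>Setting \<open>r 0 = 0\<close> makes the first increment
    \<open>b 0 = a 1 / q\<close>, which is non-negative by the sign hypothesis; the later increments
    are so by monotonicity.\<close>
  define r where "r k = (if k = 0 then 0 else a k / real (q choose k))" for k
  define b where "b j = r (Suc j) - r j" for j
  have "b j \<ge> 0" if "j < q" for j
    using that assms(2)[of 1] assms(3)[of j] by (auto simp: b_def r_def)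
  moreover have "real (q choose k) * (\<Sum>j<k. b j) = a k" if "k \<in> {1..q}" for k
    unfolding b_def sum_lessThan_telescope using that by (simp add: r_def)
  moreover have coeff: "coeff p k = (if k \<in> {1..q} then a k else 0)" for k
    by (simp add: p_def coeff_sum)
  moreover have "degree p \<le> q"
    by (intro degree_le) (simp add: coeff)
  ultimately have "approx_well_covered_indep_poly q p"
    using step_combination_approx[OF assms(1), of b] unfolding approx_well_covered_indep_poly_def
    by simp
  then show ?thesis by (simp only: p_def)
qed

end
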